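(* Let $b$ be a prime, let $s,m,\alpha,d\in\mathbb{N}$ with $\min(\alpha,d)>1$, and let $\boldsymbol{\gamma}=(\gamma_v)_{v\subseteq\{1:s\}}$ be non-negative real weights. Suppose $p\in\mathbb{F}_b[x]$ is irreducible with $\deg(p)=m$ and $q\in\mathcal{R}_m$ minimizes $B_{\alpha,d,\boldsymbol{\gamma},(1)}(\psi_{ds}(\tilde q),p)$ as a function of $\tilde q\in\mathcal{R}_m$ (Korobov construction). Then for any real $\lambda$ with $1/\min(\alpha,d)<\lambda\le1$ we have $$B_{\alpha,d,\boldsymbol{\gamma},(1)}(\psi_{ds}(q),p)\le\frac{(ds)^{1/\lambda}}{(b^m-1)^{1/\lambda}}\left[\sum_{\emptyset\ne v\subseteq\{1:s\}}\tilde\gamma_v^\lambda H_{\alpha,d,\lambda,(1)}^{|v|}\right]^{1/\lambda},$$ where $$H_{\alpha,d,\lambda,(1)}=-1+(1+\tilde H_{\alpha,d,\lambda,(1)})^d,\qquad\tilde H_{\alpha,d,\lambda,(1)}=\frac1{b^{\alpha\lambda/2}}\cdot\frac{b-1}{b^{\lambda\min(\alpha,d)}-b}.$$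
   Context: $\mathbb{N}$ is the set of positive integers, $\mathbb{N}_0=\mathbb{N}\cup\{0\}$, $\{a:c\}=\{a,\ldots,c\}$; $\mathbb{F}_b$ is the field with $b$ elements, identified with $\{0,\ldots,b-1\}$; $\mathcal{R}_m=\{q\in\mathbb{F}_b[x]:\deg(q)<m,\ q\ne0\}$. For $q\in\mathcal{R}_m$, $\psi_{ds}(q)=(1,q,q^2,\ldots,q^{ds-1})\pmod p$, each component reduced modulo $p$ to a polynomial of degree less than $m$. For $k\in\mathbb{N}_0$ with $b$-adic expansion $k=\kappa_0+\kappa_1b+\cdots$, $\mathrm{tr}_m(k)=\kappa_0+\kappa_1x+\cdots+\kappa_{m-1}x^{m-1}\in\mathbb{F}_b[x]$. For $\boldsymbol{q}=(q_1,\ldots,q_{ds})\in(\mathbb{F}_b[x])^{ds}$, $D^\perp_{\boldsymbol{q},p}=\{\boldsymbol{k}\in\mathbb{N}_0^{ds}:\sum_{j=1}^{ds}\mathrm{tr}_m(k_j)q_j\equiv0\pmod p\}$. For $k\in\mathbb{N}$, $\mu_1(k)=a$ iff $b^{a-1}\le k<b^a$. $\tilde r_{\alpha,d,(1)}(k)=b^{-\min(\alpha,d)\mu_1(k)-\alpha/2}$ for $k\ge1$ and $\tilde r_{\alpha,d,(1)}(0)=1$; $\tilde r_{\alpha,d,(1)}(\boldsymbol{k}_u)=\prod_{j\in u}\tilde r_{\alpha,d,(1)}(k_j)$. For $u\subseteq\{1:ds\}$, $w(u)$ is the set of $1\le j\le s$ with $u\cap\{(j-1)d+1:jd\}\ne\emptyset$;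 $\tilde\gamma_v=\gamma_vb^{\alpha(2d-1)|v|/2}$ for $v\subseteq\{1:s\}$. The quality criterion is $$B_{\alpha,d,\boldsymbol{\gamma},(1)}(\boldsymbol{q},p)=\sum_{\emptyset\ne u\subseteq\{1:ds\}}\tilde\gamma_{w(u)}\sum_{\substack{\boldsymbol{k}_u\in\mathbb{N}^{|u|}\\(\boldsymbol{k}_u,\boldsymbol{0})\in D^\perp_{\boldsymbol{q},p}}}\tilde r_{\alpha,d,(1)}(\boldsymbol{k}_u),$$ where $(\boldsymbol{k}_u,\boldsymbol{0})\in\mathbb{N}_0^{ds}$ has components $0$ outside $u$. (It is an upper bound on the worst-case integration error, in the weighted Walsh space of smoothness $\alpha$ with weights $\boldsymbol{\gamma}$, of the interlaced polynomial lattice rule of order $d$ with generating vector $\boldsymbol{q}$ and modulus $p$.) *)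

theory Defs
  imports
    "HOL-Analysis.Analysis"
    "HOL-Computational_Algebra.Computational_Algebra"
    "HOL-Number_Theory.Cong"
begin

text \<open>
  The field with \<open>b\<close> elements, \<open>b\<close> prime, is a type \<open>'a :: {field, finite}\<close> with
  \<open>CARD('a) = b\<close>; the identification of \<open>{0,\<dots>,b-1}\<close> with it is \<open>of_nat\<close>.
  Vectors with \<open>n\<close> components are functions on \<open>nat\<close> of which only the values at
  \<open>{1..n}\<close> matter; vectors of natural numbers are extended by \<open>0\<close> outside \<open>{1..n}\<close>.
\<close>

definition nonzero_polys_below :: "nat \<Rightarrow> 'a::field poly set" where
  "nonzero_polys_below m = {q. degree q < m \<and> q \<noteq> 0}"

definition korobov_vector :: "'a::field poly \<Rightarrow> 'a poly \<Rightarrow> nat \<Rightarrow> 'a poly" where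
  "korobov_vector p q j = q ^ (j - 1) mod p"

definition trunc_poly :: "nat \<Rightarrow> nat \<Rightarrow> nat \<Rightarrow> 'a::field poly" where
  "trunc_poly b m k = (\<Sum>i<m. monom (of_nat ((k div b ^ i) mod b)) i)"

definition dual_net ::
  "nat \<Rightarrow> nat \<Rightarrow> nat \<Rightarrow> (nat \<Rightarrow> 'a::field poly) \<Rightarrow> 'a poly \<Rightarrow> (nat \<Rightarrow> nat) set" where
  "dual_net b m n q p =
     {k. (\<forall>j. j \<notin> {1..n} \<longrightarrow> k j = 0) \<and>
         [(\<Sum>j\<in>{1..n}. trunc_poly b m (k j) * q j) = 0] (mod p)}"

definition mu1 :: "nat \<Rightarrow> nat \<Rightarrow> nat" where
  "mu1 b k = (THE a. 1 \<le> a \<and> b ^ (a - 1) \<le> k \<and> k < b ^ a)"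

definition walsh_r :: "nat \<Rightarrow> nat \<Rightarrow> nat \<Rightarrow> nat \<Rightarrow> real" where
  "walsh_r b \<alpha> d k =
     (if k = 0 then 1
      else real b powr (- (real (min \<alpha> d) * real (mu1 b k)) - real \<alpha> / 2))"

definition block_support :: "nat \<Rightarrow> nat \<Rightarrow> nat set \<Rightarrow> nat set" where
  "block_support s d u = {j\<in>{1..s}. u \<inter> {(j - 1) * d + 1..j * d} \<noteq> {}}"

definition weight_tilde :: "nat \<Rightarrow> nat \<Rightarrow> nat \<Rightarrow> (nat set \<Rightarrow> real) \<Rightarrow> nat set \<Rightarrow> real" where
  "weight_tilde b \<alpha> d \<gamma> v =
     \<gamma> v * real b powr (real \<alpha> * (2 * real d - 1) * real (card v) / 2)"

text \<open>
  In the quality criterion, a vector in \<open>\<nat>\<^sup>u\<close> padded by zeros is a function whose set of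
  nonzero arguments is exactly \<open>u\<close>. The value \<open>0\<close> that \<open>infsum\<close> gives to a divergent series
  plays no role for \<open>b > 1\<close> and \<open>min \<alpha> d > 1\<close>: see \<open>summable_quality_criterion\<close> below.
\<close>

definition quality_criterion ::
  "nat \<Rightarrow> nat \<Rightarrow> nat \<Rightarrow> nat \<Rightarrow> nat \<Rightarrow> (nat set \<Rightarrow> real) \<Rightarrow>
   (nat \<Rightarrow> 'a::field poly) \<Rightarrow> 'a poly \<Rightarrow> real" where
  "quality_criterion b m s \<alpha> d \<gamma> q p =
     (\<Sum>u\<in>Pow {1..d * s} - {{}}.
        weight_tilde b \<alpha> d \<gamma> (block_support s d u) *
        (\<Sum>\<^sub>\<infinity>k\<in>{k \<in> dual_net b m (d * s) q p. {j. k j \<noteq> 0} = u}.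
           \<Prod>j\<in>u. walsh_r b \<alpha> d (k j)))"

definition H_tilde :: "nat \<Rightarrow> nat \<Rightarrow> nat \<Rightarrow> real \<Rightarrow> real" where
  "H_tilde b \<alpha> d lam =
     1 / real b powr (real \<alpha> * lam / 2) *
     ((real b - 1) / (real b powr (lam * real (min \<alpha> d)) - real b))"

definition H_const :: "nat \<Rightarrow> nat \<Rightarrow> nat \<Rightarrow> real \<Rightarrow> real" where
  "H_const b \<alpha> d lam = - 1 + (1 + H_tilde b \<alpha> d lam) ^ d"

lemma mu1_eqI:
  assumes "b > 1" "b ^ n \<le> k" "k < b ^ Suc n"
  shows "mu1 b k = Suc n"
  unfolding mu1_def
proof (rule the_equality)
  fix a assume a: "1 \<le> a \<and> b ^ (a - 1) \<le> k \<and> k < b ^ a"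
  from a assms have "b ^ (a - 1) < b ^ Suc n" "b ^ n < b ^ a"
    by (meson le_less_trans)+
  with \<open>b > 1\<close> have "a - 1 < Suc n" "n < a"
    using power_less_imp_less_exp by blast+
  then show "a = Suc n" by linarith
qed (use assms in auto)

lemma walsh_r_nonneg: "walsh_r b \<alpha> d k \<ge> 0"
  by (simp add: walsh_r_def)

lemma sum_walsh_r_le:
  assumes b: "b > 1" and mn: "min \<alpha> d > 1"
  shows "(\<Sum>k\<in>{1..<b ^ N}. walsh_r b \<alpha> d k) \<le> 2"
proof -
  have block: "(\<Sum>k\<in>{b ^ i..<b ^ Suc i}. walsh_r b \<alpha> d k) \<le> (1 / 2) ^ i" for i
  proof -
    have "walsh_r b \<alpha> d k \<le> 1 / real b ^ (2 * Suc i)" if k: "k \<in> {b ^ i..<b ^ Suc i}" for k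
    proof -
      have mu: "mu1 b k = Suc i" using k b by (intro mu1_eqI) auto
      have "k \<ge> b ^ i" "b ^ i > 0" using k b by auto
      then have "k \<noteq> 0" by linarith
      then have "walsh_r b \<alpha> d k =
          real b powr (- (real (min \<alpha> d) * real (Suc i)) - real \<alpha> / 2)"
        using mu by (simp add: walsh_r_def)
      also have "\<dots> \<le> real b powr (- real (2 * Suc i))"
      proof (rule powr_mono)
        have "real 2 * real (Suc i) \<le> real (min \<alpha> d) * real (Suc i)"
          using mn by (intro mult_right_mono) linarith+
        then show "- (real (min \<alpha> d) * real (Suc i)) - real \<alpha> / 2 \<le> - real (2 * Suc i)"
          by simp
      qed (use b in simp)
      also have "\<dots> = 1 / real b ^ (2 * Suc i)"
        using b by (subst powr_minus, subst powr_realpow) (auto simp: divide_inverse)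
      finally show ?thesis .
    qed
    then have "(\<Sum>k\<in>{b ^ i..<b ^ Suc i}. walsh_r b \<alpha> d k) \<le>
        real (card {b ^ i..<b ^ Suc i}) * (1 / real b ^ (2 * Suc i))"
      by (rule sum_bounded_above)
    also have "\<dots> \<le> real b ^ Suc i * (1 / real b ^ (2 * Suc i))"
    proof (rule mult_right_mono)
      have "card {b ^ i..<b ^ Suc i} \<le> b ^ Suc i" by simp
      then show "real (card {b ^ i..<b ^ Suc i}) \<le> real b ^ Suc i"
        by (metis of_nat_le_iff of_nat_power)
    qed simp
    also have "\<dots> = (1 / real b) ^ Suc i"
      using b by (simp add: power_mult power2_eq_square power_mult_distrib mult.commute[of 2] mult_2_right power_add field_simps)
    also have "\<dots> \<le> (1 / 2) ^ Suc i"
      using b by (intro power_mono) (auto simp: field_simps)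
    also have "\<dots> \<le> (1 / 2) ^ i" by simp
    finally show ?thesis .
  qed
  have "(\<Sum>k\<in>{1..<b ^ N}. walsh_r b \<alpha> d k) \<le> (\<Sum>i<N. (1 / 2) ^ i)"
  proof (induction N)
    case (Suc N)
    have "b ^ N \<ge> 1" "b ^ N \<le> b ^ Suc N" using b by auto
    then have "(\<Sum>k\<in>{1..<b ^ Suc N}. walsh_r b \<alpha> d k) =
        (\<Sum>k\<in>{1..<b ^ N}. walsh_r b \<alpha> d k) + (\<Sum>k\<in>{b ^ N..<b ^ Suc N}. walsh_r b \<alpha> d k)"
      by (simp only: sum.atLeastLessThan_concat)
    with Suc block[of N] show ?case by simp
  qed simp
  also have "\<dots> \<le> 2" by (subst geometric_sum) auto
  finally show ?thesis .
qed

lemma summable_quality_criterion: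
  fixes q :: "nat \<Rightarrow> 'a::field poly"
  assumes b: "b > 1" and mn: "min \<alpha> d > 1" and u: "finite u"
  shows "(\<lambda>k. \<Prod>j\<in>u. walsh_r b \<alpha> d (k j)) summable_on
           {k \<in> dual_net b m (d * s) q p. {j. k j \<noteq> 0} = u}"
proof (rule nonneg_bdd_above_summable_on)
  let ?A = "{k \<in> dual_net b m (d * s) q p. {j. k j \<noteq> 0} = u}"
  let ?f = "\<lambda>k. \<Prod>j\<in>u. walsh_r b \<alpha> d (k j)"
  show "?f k \<ge> 0" for k by (simp add: prod_nonneg walsh_r_nonneg)
  show "bdd_above (sum ?f ` {F. F \<subseteq> ?A \<and> finite F})"
  proof (rule bdd_aboveI2)
    fix F assume "F \<in> {F. F \<subseteq> ?A \<and> finite F}"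
    then have F: "F \<subseteq> ?A" "finite F" by auto
    define N where "N = Suc (\<Sum>k\<in>F. \<Sum>j\<in>u. k j)"
    have le: "k j \<in> {1..<b ^ N}" if "k \<in> F" "j \<in> u" for k j
    proof -
      have "k j \<le> (\<Sum>j\<in>u. k j)" using that u by (intro member_le_sum) auto
      also have "\<dots> \<le> (\<Sum>k\<in>F. \<Sum>j\<in>u. k j)"
        using that F by (intro member_le_sum[of _ _ "\<lambda>k. \<Sum>j\<in>u. k j"]) auto
      finally have "k j < N" by (simp add: N_def)
      also have "N < b ^ N" using b by (simp add: power_gt_expt)
      finally show ?thesis using that F by auto
    qed
    have inj: "inj_on (\<lambda>k. restrict k u) F"
    proof (rule inj_onI)
      fix k l assume kl: "k \<in> F" "l \<in> F" "restrict k u = restrict l u"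
      then have "k j = l j" if "j \<in> u" for j using that by (metis restrict_apply')
      moreover have "k j = l j" if "j \<notin> u" for j
      proof -
        from kl F have "{j. k j \<noteq> 0} = u" "{j. l j \<noteq> 0} = u" by blast+
        with that have "k j = 0" "l j = 0" by blast+
        then show ?thesis by simp
      qed
      ultimately show "k = l" by blast
    qed
    have "sum ?f F = sum ?f ((\<lambda>k. restrict k u) ` F)"
      by (subst sum.reindex[OF inj]) (auto intro!: sum.cong prod.cong)
    also have "\<dots> \<le> sum ?f (PiE u (\<lambda>_. {1..<b ^ N}))"
      using u le by (intro sum_mono2) (auto intro!: finite_PiE prod_nonneg walsh_r_nonneg)
    also have "\<dots> = (\<Prod>j\<in>u. \<Sum>k\<in>{1..<b ^ N}. walsh_r b \<alpha> d k)"
      using u by (subst prod_sum_PiE) auto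
    also have "\<dots> \<le> (\<Prod>j\<in>u. 2)"
      using sum_walsh_r_le[OF b mn]
      by (intro prod_mono) (auto intro!: sum_nonneg walsh_r_nonneg)
    finally show "sum ?f F \<le> (\<Prod>j\<in>u. 2)" .
  qed
qed

end

theory Submission
  imports Defs
begin

text \<open>
  By minimality, the \<open>\<lambda>\<close>-th power of the criterion at \<open>q\<close> is at most the average of the
  \<open>\<lambda>\<close>-th powers over all \<open>b\<^sup>m - 1\<close> candidates, and Jensen's inequality
  \<open>(\<Sum> a)\<^sup>\<lambda> \<le> \<Sum> a\<^sup>\<lambda>\<close> moves the power inside. After exchanging the sums, each \<open>k\<close> with
  support \<open>u\<close> is counted once for every \<open>q'\<close> that is a root modulo \<open>p\<close> of the polynomial
  with coefficients \<open>tr\<^sub>m(k\<^sub>j)\<close>. There are at most \<open>d s - 1\<close> such roots, unless \<open>b\<^sup>m\<close> divides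
  all \<open>k\<^sub>j\<close>; the latter \<open>k\<close> contribute, even when counted for all \<open>q'\<close>, at most one more
  copy of the full sum, since \<open>k = b\<^sup>m l\<close> costs a factor
  \<open>b\<close> to the power \<open>- \<lambda> min(\<alpha>, d) m\<close>, which is below \<open>b\<close> to the power \<open>- m\<close>.
\<close>

section \<open>Jensen's inequality for series\<close>

text \<open>With \<open>t = z / (x + y)\<close> in the unit interval,
  \<open>t \<le> t powr l\<close> because \<open>l \<le> 1\<close>. Taking \<open>z = x\<close> and
  \<open>z = y\<close>, whose fractions add up to 1, gives the claim.\<close>

lemma powr_subadditive:
  fixes x y l :: real
  assumes "x \<ge> 0" "y \<ge> 0" "0 < l" "l \<le> 1"
  shows "(x + y) powr l \<le> x powr l + y powr l"
proof (cases "x + y = 0")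
  case True
  with assms show ?thesis by simp
next
  case False
  with assms have pos: "x + y > 0" by linarith
  have *: "z / (x + y) * (x + y) powr l \<le> z powr l" if z: "0 \<le> z" "z \<le> x + y" for z
  proof -
    define t where "t = z / (x + y)"
    have t: "0 \<le> t" "t \<le> 1" using z pos by (auto simp: t_def)
    have "t powr 1 \<le> t powr l" using t assms by (intro powr_mono') auto
    with t have "t \<le> t powr l" by simp
    then have "t * (x + y) powr l \<le> t powr l * (x + y) powr l" by (intro mult_right_mono) auto
    also have "\<dots> = (t * (x + y)) powr l" using t pos by (simp add: powr_mult)
    also have "t * (x + y) = z" using pos by (simp add: t_def)
    finally show ?thesis by (simp add: t_def)
  qed
  have "(x + y) powr l = x / (x + y) * (x + y) powr l + y / (x + y) * (x + y) powr l"
    using pos by (simp flip: distrib_right add_divide_distrib)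
  also have "\<dots> \<le> x powr l + y powr l"
    using assms by (intro add_mono *) auto
  finally show ?thesis .
qed

lemma sum_powr_le:
  fixes f :: "'i \<Rightarrow> real"
  assumes "finite F" "\<And>i. i \<in> F \<Longrightarrow> f i \<ge> 0" "0 < l" "l \<le> 1"
  shows "(\<Sum>i\<in>F. f i) powr l \<le> (\<Sum>i\<in>F. f i powr l)"
  using assms(1,2)
proof (induction F)
  case (insert i F)
  have "(f i + sum f F) powr l \<le> f i powr l + sum f F powr l"
    using insert assms by (intro powr_subadditive sum_nonneg) auto
  with insert show ?case by force
qed simp

text \<open>By the finite case, every finite partial sum of \<open>f\<close> is at most the
  right-hand side raised to \<open>1 / l\<close>. This bound is the same for all finite sets, so it
  passes to \<open>infsum f A\<close>, and raising to the power \<open>l\<close> finishes.\<close>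

lemma infsum_powr_le:
  fixes f :: "'i \<Rightarrow> real"
  assumes nn: "\<And>i. i \<in> A \<Longrightarrow> f i \<ge> 0" and l: "0 < l" "l \<le> 1"
    and sf: "f summable_on A" and sl: "(\<lambda>i. f i powr l) summable_on A"
  shows "infsum f A powr l \<le> (\<Sum>\<^sub>\<infinity>i\<in>A. f i powr l)"
proof -
  let ?T = "\<Sum>\<^sub>\<infinity>i\<in>A. f i powr l"
  have "infsum f A \<le> ?T powr (1 / l)"
  proof (rule infsum_le_finite_sums[OF sf])
    fix F assume F: "finite F" "F \<subseteq> A"
    have "sum f F powr l \<le> (\<Sum>i\<in>F. f i powr l)"
      using F nn l by (intro sum_powr_le) auto
    also have "\<dots> \<le> ?T" using F by (intro finite_sum_le_infsum[OF sl]) auto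
    finally have "(sum f F powr l) powr (1 / l) \<le> ?T powr (1 / l)"
      using l by (intro powr_mono2) auto
    moreover have "sum f F \<ge> 0" using F nn by (intro sum_nonneg) auto
    ultimately show "sum f F \<le> ?T powr (1 / l)" using l by (simp add: powr_powr)
  qed
  then have "infsum f A powr l \<le> (?T powr (1 / l)) powr l"
    using l nn by (intro powr_mono2 infsum_nonneg) auto
  moreover have "?T \<ge> 0" by (intro infsum_nonneg) auto
  ultimately show ?thesis using l by (simp add: powr_powr)
qed

section \<open>Roots modulo an irreducible polynomial\<close>

text \<open>Lagrange's bound on the number of roots modulo a prime, phrased by divisibility instead
  of in a quotient ring; \<open>[:p:] dvd P\<close> says that \<open>P\<close> vanishes modulo
  \<open>p\<close>. Synthetic division splits off one root \<open>a\<close>. For any other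
  \<open>x\<close> in \<open>S\<close>, \<open>p\<close> does not divide \<open>x - a\<close>, so
  primality makes \<open>x\<close> a root modulo \<open>p\<close> of the quotient, whose degree is
  smaller.\<close>

lemma prime_elem_dvd_coeffs_if_many_roots:
  fixes P :: "'a::idom poly"
  assumes p: "prime_elem p" and "degree P < card S"
    and "\<And>x y. x \<in> S \<Longrightarrow> y \<in> S \<Longrightarrow> p dvd x - y \<Longrightarrow> x = y"
    and "\<And>x. x \<in> S \<Longrightarrow> p dvd poly P x"
  shows "[:p:] dvd P"
  using assms(2-)
proof (induction "degree P" arbitrary: P S rule: less_induct)
  case less
  have fin: "finite S" using less.prems(1) by (metis card.infinite not_less_zero)
  obtain a where a: "a \<in> S" using less.prems(1) by fastforce
  define Q where "Q = synthetic_div P a"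
  have PQ: "P = [:-a, 1:] * Q + [:poly P a:]"
    unfolding Q_def by (rule synthetic_div_correct'[symmetric])
  have pa: "p dvd poly P a" using less.prems a by blast
  show ?case
  proof (cases "degree P = 0")
    case True
    then have "Q = 0" by (simp add: Q_def synthetic_div_eq_0_iff)
    with PQ have "P = [:poly P a:]" by simp
    moreover have "[:p:] dvd [:poly P a:]" using pa by (simp add: const_poly_dvd_const_poly_iff)
    ultimately show ?thesis by simp
  next
    case False
    have "[:p:] dvd Q"
    proof (rule less.hyps[of Q "S - {a}"])
      have dQ: "degree Q = degree P - 1" by (simp add: Q_def degree_synthetic_div)
      with False show "degree Q < degree P" by simp
      show "degree Q < card (S - {a})" using dQ False less.prems(1) a fin by simp
      show "x = y" if "x \<in> S - {a}" "y \<in> S - {a}" "p dvd x - y" for x y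
        using that less.prems(2) by blast
      fix x assume x: "x \<in> S - {a}"
      have "poly P x = (x - a) * poly Q x + poly P a"
        by (subst PQ) (simp add: algebra_simps)
      moreover have "p dvd poly P x" using x less.prems by blast
      ultimately have "p dvd (x - a) * poly Q x"
        using pa by (metis dvd_add_left_iff)
      moreover have "\<not> p dvd x - a" using x a less.prems(2) by blast
      ultimately show "p dvd poly Q x" using p by (metis prime_elem_dvd_multD)
    qed
    moreover have "[:p:] dvd [:poly P a:]" using pa by (simp add: const_poly_dvd_const_poly_iff)
    ultimately show ?thesis using PQ by (metis dvd_add dvd_mult)
  qed
qed

lemma degree_less_dvd_imp_eq_0:
  fixes p q :: "'a::field poly"
  assumes "p dvd q" "degree q < degree p"
  shows "q = 0"
  using assms dvd_imp_degree_le[of p q] by linarith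

text \<open>The sum is the value at \<open>x\<close> of a polynomial of degree at most
  \<open>n - 1\<close> with coefficients \<open>c j\<close>. Candidates of degree below
  \<open>m\<close> are pairwise incongruent modulo \<open>p\<close>, so \<open>n\<close> roots would
  force \<open>p\<close> to divide every \<open>c j\<close>; but a multiple of \<open>p\<close> of
  degree below \<open>m\<close> is 0.\<close>

lemma card_roots_below_le:
  fixes p :: "'a::{field, finite} poly"
  assumes p: "irreducible p" "degree p = m"
    and c: "\<And>j. j \<in> {1..n} \<Longrightarrow> degree (c j) < m"
    and j: "j \<in> {1..n}" "c j \<noteq> 0"
  shows "card {x \<in> nonzero_polys_below m. p dvd (\<Sum>j\<in>{1..n}. c j * x ^ (j - 1))} \<le> n - 1"
proof (rule ccontr)
  let ?S = "{x \<in> nonzero_polys_below m. p dvd (\<Sum>j\<in>{1..n}. c j * x ^ (j - 1))}"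
  define P where "P = (\<Sum>j\<in>{1..n}. monom (c j) (j - 1))"
  assume "\<not> card ?S \<le> n - 1"
  moreover have "degree P \<le> n - 1" unfolding P_def
    by (intro degree_sum_le order.trans[OF degree_monom_le]) auto
  ultimately have "degree P < card ?S" by linarith
  then have "[:p:] dvd P"
  proof (rule prime_elem_dvd_coeffs_if_many_roots[OF field_poly_irreducible_imp_prime[OF p(1)]])
    fix x y assume xy: "x \<in> ?S" "y \<in> ?S" "p dvd x - y"
    then have "degree (x - y) < degree p"
      using p by (auto simp: nonzero_polys_below_def intro!: degree_diff_less)
    with xy show "x = y" using degree_less_dvd_imp_eq_0[of p "x - y"] by simp
  next
    fix x assume "x \<in> ?S"
    then show "p dvd poly P x" by (simp add: P_def poly_sum poly_monom)
  qed
  then have "p dvd coeff P (j - 1)" by (simp add: const_poly_dvd_iff)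
  \<comment> \<open>Indices start at 1, so \<open>j - 1\<close> is injective on them despite
    truncated subtraction, and only one monomial reaches this coefficient.\<close>
  also have "coeff P (j - 1) = (\<Sum>i\<in>{1..n}. if i = j then c i else 0)"
    unfolding P_def coeff_sum coeff_monom using j by (intro sum.cong) auto
  also have "\<dots> = c j" using j by simp
  finally show False using c[OF j(1)] j(2) p(2) degree_less_dvd_imp_eq_0 by blast
qed

section \<open>Counting polynomials of bounded degree\<close>

lemma card_polys_degree_less:
  assumes "m \<ge> 1"
  shows "finite {q :: 'a::{field, finite} poly. degree q < m}" (is "finite ?D")
    and "card {q :: 'a poly. degree q < m} = CARD('a) ^ m"
proof -
  let ?E = "PiE {..<m} (\<lambda>_. UNIV :: 'a set)"
  have "bij_betw (\<lambda>q. restrict (coeff q) {..<m}) ?D ?E"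
  proof (rule bij_betw_byWitness[where f' = "\<lambda>f. \<Sum>i<m. monom (f i) i"])
    show "\<forall>q\<in>?D. (\<Sum>i<m. monom (restrict (coeff q) {..<m} i) i) = q"
    proof
      fix q :: "'a poly" assume "q \<in> ?D"
      then show "(\<Sum>i<m. monom (restrict (coeff q) {..<m} i) i) = q"
        by (intro poly_eqI) (auto simp: coeff_sum coeff_eq_0)
    qed
    show "\<forall>f\<in>?E. restrict (coeff (\<Sum>i<m. monom (f i) i)) {..<m} = f"
      by (auto simp: coeff_sum PiE_def extensional_def fun_eq_iff)
    \<comment> \<open>This is where \<open>m \<ge> 1\<close> enters: the zero polynomial has
      \<open>degree\<close> 0, so for \<open>m = 0\<close> the set would be empty and not of size
      1.\<close>
    have "degree (\<Sum>i<m. monom (f i) i) < m" for f :: "nat \<Rightarrow> 'a"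
    proof -
      have "degree (\<Sum>i<m. monom (f i) i) \<le> m - 1"
        by (intro degree_sum_le order.trans[OF degree_monom_le]) auto
      with assms show ?thesis by linarith
    qed
    then show "(\<lambda>f. \<Sum>i<m. monom (f i) i) ` ?E \<subseteq> ?D" by auto
  qed (auto split: if_splits)
  moreover have "finite ?E" "card ?E = CARD('a) ^ m" by (auto simp: card_PiE intro!: finite_PiE)
  ultimately show "finite ?D" "card ?D = CARD('a) ^ m"
    by (metis bij_betw_finite, metis bij_betw_same_card)
qed

lemma card_nonzero_polys_below:
  assumes "m \<ge> 1"
  shows "finite (nonzero_polys_below m :: 'a::{field, finite} poly set)"
    and "card (nonzero_polys_below m :: 'a poly set) = CARD('a) ^ m - 1"
proof -
  have eq: "nonzero_polys_below m = {q :: 'a poly. degree q < m} - {0}"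
    by (auto simp: nonzero_polys_below_def)
  show "finite (nonzero_polys_below m :: 'a poly set)"
    unfolding eq using card_polys_degree_less(1)[OF assms] by simp
  show "card (nonzero_polys_below m :: 'a poly set) = CARD('a) ^ m - 1"
    unfolding eq using card_polys_degree_less[OF assms, where 'a = 'a] assms
    by (subst card_Diff_singleton) auto
qed

section \<open>Base-\<open>b\<close> digits, truncation polynomials and the dual net\<close>

lemma power_dvd_if_digits_0:
  fixes b k :: nat
  assumes "\<And>i. i < m \<Longrightarrow> (k div b ^ i) mod b = 0"
  shows "b ^ m dvd k"
  using assms
proof (induction m)
  case (Suc m)
  then have "b ^ m dvd k" by simp
  moreover have "b dvd k div b ^ m" using Suc.prems[of m] by (simp add: mod_eq_0_iff_dvd)
  ultimately have "b ^ m * b dvd b ^ m * (k div b ^ m)" by (intro mult_dvd_mono) auto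
  with \<open>b ^ m dvd k\<close> show ?case by (simp add: mult.commute)
qed simp

lemma coeff_trunc_poly:
  "coeff (trunc_poly b m k) i = (if i < m then of_nat ((k div b ^ i) mod b) else 0)"
  by (auto simp: trunc_poly_def coeff_sum)

lemma degree_trunc_poly:
  assumes "m \<ge> 1"
  shows "degree (trunc_poly b m k :: 'a::field poly) < m"
proof -
  have "degree (trunc_poly b m k :: 'a poly) \<le> m - 1" by (rule degree_le) (auto simp: coeff_trunc_poly)
  with assms show ?thesis by linarith
qed

text \<open>The translation by 1 permutes the field, so the sum of all elements is unchanged when
  \<open>CARD('a)\<close> ones are added to it. Hence the characteristic divides the prime
  \<open>CARD('a)\<close>, and it is not 1.\<close>

lemma CHAR_finite_field_prime_card:
  assumes "prime CARD('a::{field, finite})"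
  shows "CHAR('a) = CARD('a)"
proof -
  have "(\<Sum>x\<in>UNIV. x) = (\<Sum>x\<in>UNIV. x + 1 :: 'a)"
    by (rule sum.reindex_bij_betw[symmetric])
       (auto intro!: bij_betw_byWitness[where f' = "\<lambda>x. x - 1"])
  then have "of_nat CARD('a) = (0 :: 'a)" by (simp add: sum.distrib)
  then have "CHAR('a) dvd CARD('a)" by (simp add: of_nat_eq_0_iff_char_dvd)
  with assms show ?thesis by (metis CHAR_not_1' One_nat_def prime_nat_iff)
qed

text \<open>The characteristic is \<open>b\<close>, so \<open>of_nat\<close> sends no nonzero digit
  to 0, and a vanishing truncation forces the lowest \<open>m\<close> digits of \<open>k\<close> to
  be 0.\<close>

lemma power_dvd_if_trunc_poly_eq_0:
  assumes "prime b" "CARD('a::{field, finite}) = b" "trunc_poly b m k = (0 :: 'a poly)"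
  shows "b ^ m dvd k"
proof (rule power_dvd_if_digits_0)
  fix i assume "i < m"
  then have "of_nat ((k div b ^ i) mod b) = (0 :: 'a)"
    using assms(3) coeff_trunc_poly[of b m k i, where 'a = 'a] by simp
  moreover have "CHAR('a) = b"
    using CHAR_finite_field_prime_card assms(1,2) by blast
  ultimately have "b dvd (k div b ^ i) mod b" by (simp add: of_nat_eq_0_iff_char_dvd)
  moreover have "(k div b ^ i) mod b < b" using assms(1) by (simp add: prime_gt_0_nat)
  ultimately show "(k div b ^ i) mod b = 0" by (metis nat_dvd_not_less not_gr_zero)
qed

text \<open>Reducing the powers of \<open>q\<close> modulo \<open>p\<close> does not affect the
  congruence. Membership of \<open>k\<close> thus says that \<open>q\<close> is a root modulo
  \<open>p\<close> of the polynomial with coefficients \<open>trunc_poly b m (k j)\<close>, which is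
  the form in which roots can be counted.\<close>

lemma mem_dual_net_korobov_iff:
  "k \<in> dual_net b m n (korobov_vector p q) p \<longleftrightarrow>
     (\<forall>j. j \<notin> {1..n} \<longrightarrow> k j = 0) \<and>
     p dvd (\<Sum>j\<in>{1..n}. trunc_poly b m (k j) * q ^ (j - 1))"
proof -
  have "[(\<Sum>j\<in>{1..n}. trunc_poly b m (k j) * (q ^ (j - 1) mod p)) =
      (\<Sum>j\<in>{1..n}. trunc_poly b m (k j) * q ^ (j - 1))] (mod p)"
    by (intro cong_sum cong_mult) (auto simp: cong_def)
  then show ?thesis
    unfolding dual_net_def korobov_vector_def mem_Collect_eq cong_0_iff
    by (simp only: cong_dvd_iff)
qed

section \<open>Sums over vectors of given support\<close>

text \<open>Vectors in \<open>K\<close> vanish off \<open>u\<close>, so restriction to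
  \<open>u\<close> embeds \<open>K\<close> into a finite box \<open>F\<close> to the power
  \<open>u\<close>, over which the sum of products factorizes. Since \<open>C\<close> bounds all
  finite partial sums of \<open>g\<close> over \<open>B\<close>, the result is independent of
  \<open>K\<close>.\<close>

lemma sum_prod_support_le:
  fixes g :: "nat \<Rightarrow> real"
  assumes u: "finite u" and g: "\<And>i. g i \<ge> 0"
    and C: "\<And>F. finite F \<Longrightarrow> F \<subseteq> B \<Longrightarrow> sum g F \<le> C"
    and K: "finite K" "K \<subseteq> {k. {j. k j \<noteq> 0} = u \<and> (\<forall>j\<in>u. k j \<in> B)}"
  shows "(\<Sum>k\<in>K. \<Prod>j\<in>u. g (k j)) \<le> C ^ card u"
proof -
  define F where "F = (\<Union>k\<in>K. k ` u)"
  have F: "finite F" "F \<subseteq> B" using K u by (auto simp: F_def)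
  have inj: "inj_on (\<lambda>k. restrict k u) K"
  proof (rule inj_onI)
    fix k l assume kl: "k \<in> K" "l \<in> K" "restrict k u = restrict l u"
    then have supp: "{j. k j \<noteq> 0} = u" "{j. l j \<noteq> 0} = u" using K by blast+
    have "k j = l j" for j
    proof (cases "j \<in> u")
      case True
      with kl(3) show ?thesis by (metis restrict_apply')
    next
      case False
      with supp have "k j = 0" "l j = 0" by blast+
      then show ?thesis by simp
    qed
    then show "k = l" by blast
  qed
  have "(\<Sum>k\<in>K. \<Prod>j\<in>u. g (k j)) = (\<Sum>k\<in>(\<lambda>k. restrict k u) ` K. \<Prod>j\<in>u. g (k j))"
    by (subst sum.reindex[OF inj]) (auto intro!: sum.cong prod.cong)
  also have "\<dots> \<le> (\<Sum>k\<in>PiE u (\<lambda>_. F). \<Prod>j\<in>u. g (k j))"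
    using u F g by (intro sum_mono2) (auto intro!: finite_PiE prod_nonneg simp: F_def)
  also have "\<dots> = (\<Prod>j\<in>u. sum g F)" using u F by (subst prod_sum_PiE) auto
  also have "\<dots> \<le> (\<Prod>j\<in>u. C)"
    using C[OF F] g by (intro prod_mono) (auto intro!: sum_nonneg)
  finally show ?thesis by simp
qed

text \<open>The set \<open>B\<close> of admissible entries is a parameter because two choices occur:
  all positive integers, and the positive multiples of \<open>b ^ m\<close>.\<close>

lemma summable_infsum_prod_support:
  fixes g :: "nat \<Rightarrow> real"
  assumes "finite u" "\<And>i. g i \<ge> 0"
    and "\<And>F. finite F \<Longrightarrow> F \<subseteq> B \<Longrightarrow> sum g F \<le> C"
    and A: "A \<subseteq> {k. {j. k j \<noteq> 0} = u \<and> (\<forall>j\<in>u. k j \<in> B)}"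
  shows "(\<lambda>k. \<Prod>j\<in>u. g (k j)) summable_on A"
    and "(\<Sum>\<^sub>\<infinity>k\<in>A. \<Prod>j\<in>u. g (k j)) \<le> C ^ card u"
proof -
  have bd: "(\<Sum>k\<in>K. \<Prod>j\<in>u. g (k j)) \<le> C ^ card u" if "finite K" "K \<subseteq> A" for K
    using that A by (intro sum_prod_support_le[OF assms(1-3)]) auto
  show sm: "(\<lambda>k. \<Prod>j\<in>u. g (k j)) summable_on A"
    using assms(2) bd
    by (intro nonneg_bdd_above_summable_on bdd_aboveI2[where M = "C ^ card u"])
       (auto intro!: prod_nonneg)
  show "(\<Sum>\<^sub>\<infinity>k\<in>A. \<Prod>j\<in>u. g (k j)) \<le> C ^ card u"
    using bd by (intro infsum_le_finite_sums[OF sm])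
qed

section \<open>One-dimensional sums of powers of the Walsh weights\<close>

lemma H_tilde_nonneg:
  assumes "b > 1" "lam * real (min \<alpha> d) > 1"
  shows "H_tilde b \<alpha> d lam \<ge> 0"
proof -
  have "real b powr 1 < real b powr (lam * real (min \<alpha> d))"
    using assms by (intro powr_less_mono) auto
  then show ?thesis using assms by (simp add: H_tilde_def)
qed

text \<open>On the \<open>(b - 1) * b ^ i\<close> integers with exactly \<open>i + 1\<close> digits,
  \<open>walsh_r\<close> is constant. The value is arranged as a constant times the
  \<open>i\<close>-th power of a fixed ratio, ready for a geometric series.\<close>

lemma sum_walsh_r_powr_block:
  assumes b: "b > 1"
  shows "(\<Sum>k\<in>{b ^ i..<b ^ Suc i}. walsh_r b \<alpha> d k powr lam) =
    real b powr (- (real \<alpha> * lam / 2)) * (real b - 1) * real b powr (- (lam * real (min \<alpha> d)))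
      * (real b powr (1 - lam * real (min \<alpha> d))) ^ i"
proof -
  let ?M = "real (min \<alpha> d)"
  have "walsh_r b \<alpha> d k powr lam = real b powr (- (lam * ?M * real (Suc i)) - real \<alpha> * lam / 2)"
    if k: "k \<in> {b ^ i..<b ^ Suc i}" for k
  proof -
    have "b ^ i > 0" "b ^ i \<le> k" using k b by auto
    then have "k \<noteq> 0" by linarith
    moreover have "mu1 b k = Suc i" using k b by (intro mu1_eqI) auto
    ultimately have "walsh_r b \<alpha> d k powr lam =
        real b powr ((- (?M * real (Suc i)) - real \<alpha> / 2) * lam)"
      by (simp add: walsh_r_def powr_powr)
    also have "(- (?M * real (Suc i)) - real \<alpha> / 2) * lam
        = - (lam * ?M * real (Suc i)) - real \<alpha> * lam / 2"
      by (simp add: algebra_simps)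
    finally show ?thesis .
  qed
  then have "(\<Sum>k\<in>{b ^ i..<b ^ Suc i}. walsh_r b \<alpha> d k powr lam) =
     real (card {b ^ i..<b ^ Suc i}) * real b powr (- (lam * ?M * real (Suc i)) - real \<alpha> * lam / 2)"
    by simp
  also have "card {b ^ i..<b ^ Suc i} = (b - 1) * b ^ i" by (simp add: algebra_simps)
  also have "real ((b - 1) * b ^ i) = (real b - 1) * real b powr real i"
    using b by (simp add: powr_realpow of_nat_diff)
  also have "(real b - 1) * real b powr real i
      * real b powr (- (lam * ?M * real (Suc i)) - real \<alpha> * lam / 2)
      = (real b - 1) * real b powr (real i + (- (lam * ?M * real (Suc i)) - real \<alpha> * lam / 2))"
    by (simp only: powr_add mult.assoc)
  also have "real i + (- (lam * ?M * real (Suc i)) - real \<alpha> * lam / 2) =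
      - (real \<alpha> * lam / 2) + (- (lam * ?M)) + (1 - lam * ?M) * real i"
    by (simp add: algebra_simps)
  also have "real b powr \<dots> = real b powr (- (real \<alpha> * lam / 2)) * real b powr (- (lam * ?M))
      * (real b powr (1 - lam * ?M)) ^ i"
    using b by (simp only: powr_add powr_powr[symmetric] powr_realpow) (simp add: powr_realpow)
  finally show ?thesis by (simp only: mult_ac)
qed

text \<open>Summed over the digit lengths, the blocks form a geometric series. Its ratio is below 1
  because \<open>lam * min \<alpha> d > 1\<close>, and its full sum is exactly
  \<open>H_tilde\<close>.\<close>

lemma sum_walsh_r_powr_le:
  assumes b: "b > 1" and lam: "lam * real (min \<alpha> d) > 1" and F: "finite F" "0 \<notin> F"
  shows "(\<Sum>k\<in>F. walsh_r b \<alpha> d k powr lam) \<le> H_tilde b \<alpha> d lam"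
proof -
  let ?g = "\<lambda>k. walsh_r b \<alpha> d k powr lam"
  define M where "M = lam * real (min \<alpha> d)"
  define x where "x = real b powr (1 - M)"
  define c where "c = real b powr (- (real \<alpha> * lam / 2)) * (real b - 1) * real b powr (- M)"
  have x: "0 < x" "x < 1"
    using b lam powr_less_mono[of "1 - M" 0 "real b"] by (auto simp: x_def M_def)
  have c: "c \<ge> 0" using b by (simp add: c_def)
  \<comment> \<open>A crude exponent: every element of \<open>F\<close> is at most the sum of
    \<open>F\<close>, hence below \<open>N\<close>, hence below \<open>b ^ N\<close>.\<close>
  define N where "N = Suc (\<Sum>F)"
  have "F \<subseteq> {1..<b ^ N}"
  proof
    fix k assume k: "k \<in> F"
    then have "k \<le> \<Sum>F" using F member_le_sum[of k F "\<lambda>k. k"] by simp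
    then have "k < N" by (simp add: N_def)
    also have "N < b ^ N" using b by (simp add: power_gt_expt)
    finally show "k \<in> {1..<b ^ N}" using k F by (cases "k = 0") auto
  qed
  then have "sum ?g F \<le> sum ?g {1..<b ^ N}" by (intro sum_mono2) auto
  also have "\<dots> = (\<Sum>i<N. c * x ^ i)"
  proof (induction N)
    case (Suc N)
    have "b ^ N \<ge> 1" "b ^ N \<le> b ^ Suc N" using b by auto
    then have "sum ?g {1..<b ^ Suc N} = sum ?g {1..<b ^ N} + sum ?g {b ^ N..<b ^ Suc N}"
      by (simp only: sum.atLeastLessThan_concat)
    also have "sum ?g {b ^ N..<b ^ Suc N} = c * x ^ N"
      unfolding sum_walsh_r_powr_block[OF b] c_def x_def M_def by simp
    finally show ?case using Suc by simp
  qed simp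
  also have "\<dots> = c * (\<Sum>i<N. x ^ i)" by (simp add: sum_distrib_left)
  also have "\<dots> \<le> c * (1 / (1 - x))"
    using c x sum_le_suminf[of "\<lambda>i. x ^ i" "{..<N}"]
    by (intro mult_left_mono) (auto simp: suminf_geometric summable_geometric)
  also have "\<dots> = real b powr (- (real \<alpha> * lam / 2)) * (real b - 1) * (real b powr (- M) / (1 - x))"
    by (simp add: c_def)
  \<comment> \<open>The ratio satisfies \<open>b powr M * x = b\<close>, which produces the
    denominator of \<open>H_tilde\<close>.\<close>
  also have "real b powr (- M) / (1 - x) = 1 / (real b powr M - real b)"
  proof -
    have "real b powr M * (1 - x) = real b powr M - real b powr (M + (1 - M))"
      by (simp only: x_def powr_add right_diff_distrib mult_1_right)
    also have "\<dots> = real b powr M - real b" using b by simp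
    finally have eq: "real b powr M * (1 - x) = real b powr M - real b" .
    show ?thesis unfolding powr_minus eq[symmetric] by (simp add: divide_inverse)
  qed
  also have "real b powr (- (real \<alpha> * lam / 2)) * (real b - 1) * \<dots> = H_tilde b \<alpha> d lam"
    unfolding H_tilde_def M_def powr_minus divide_inverse by (simp only: mult_1_left mult.assoc)
  finally show ?thesis .
qed

lemma mu1_power_mult:
  assumes b: "b > 1" and l: "l > 0"
  shows "mu1 b (b ^ m * l) = m + mu1 b l"
proof -
  obtain n where n: "b ^ n \<le> l" "l < b ^ Suc n"
    using b l ex_power_ivl1[of b l] by auto
  have "b ^ (m + n) \<le> b ^ m * l" using n by (simp add: power_add)
  moreover have "b ^ m * l < b ^ Suc (m + n)"
    using n b by (simp add: power_add mult.left_commute)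
  ultimately have "mu1 b (b ^ m * l) = Suc (m + n)" using b by (intro mu1_eqI)
  moreover have "mu1 b l = Suc n" using b n by (intro mu1_eqI)
  ultimately show ?thesis by simp
qed

text \<open>Writing \<open>k = b ^ m * l\<close> raises \<open>mu1\<close> by \<open>m\<close>,
  which costs a factor of at most \<open>1 / b ^ m\<close>. This gain later pays for counting such
  \<open>k\<close> once for every candidate.\<close>

lemma sum_walsh_r_powr_multiples_le:
  assumes b: "b > 1" and lam: "lam * real (min \<alpha> d) > 1"
    and F: "finite F" "\<And>k. k \<in> F \<Longrightarrow> k > 0 \<and> b ^ m dvd k"
  shows "(\<Sum>k\<in>F. walsh_r b \<alpha> d k powr lam) \<le> H_tilde b \<alpha> d lam / real b ^ m"
proof -
  let ?G = "(\<lambda>k. k div b ^ m) ` F"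
  have le: "walsh_r b \<alpha> d (b ^ m * l) powr lam \<le> walsh_r b \<alpha> d l powr lam / real b ^ m"
    if "l > 0" for l
  proof -
    let ?M = "real (min \<alpha> d)"
    have "walsh_r b \<alpha> d (b ^ m * l) powr lam =
        real b powr ((- (?M * (real m + real (mu1 b l))) - real \<alpha> / 2) * lam)"
      using that b by (simp add: walsh_r_def mu1_power_mult powr_powr)
    also have "(- (?M * (real m + real (mu1 b l))) - real \<alpha> / 2) * lam =
        (- (?M * real (mu1 b l)) - real \<alpha> / 2) * lam + - (lam * ?M * real m)"
      by (simp add: algebra_simps)
    also have "real b powr \<dots> = walsh_r b \<alpha> d l powr lam * real b powr (- (lam * ?M * real m))"
      using that by (subst powr_add) (simp add: walsh_r_def powr_powr)
    also have "\<dots> \<le> walsh_r b \<alpha> d l powr lam * (1 / real b ^ m)"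
    proof (rule mult_left_mono)
      have "1 * real m \<le> lam * ?M * real m" using lam by (intro mult_right_mono) auto
      then have "real b powr (- (lam * ?M * real m)) \<le> real b powr (- real m)"
        using b by (intro powr_mono) auto
      also have "real b powr (- real m) = 1 / real b ^ m"
        using b by (simp add: powr_minus powr_realpow divide_inverse)
      finally show "real b powr (- (lam * ?M * real m)) \<le> 1 / real b ^ m" .
    qed simp
    finally show ?thesis by simp
  qed
  have pos: "l > 0" if "l \<in> ?G" for l
  proof -
    obtain k where "k \<in> F" "l = k div b ^ m" using \<open>l \<in> ?G\<close> by blast
    with F(2)[of k] show ?thesis by (auto elim!: dvdE)
  qed
  have inj: "inj_on (\<lambda>l. b ^ m * l) ?G" using b by (auto intro!: inj_onI)
  have "(\<lambda>l. b ^ m * l) ` ?G = F" using F by (force simp: image_image)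
  then have "(\<Sum>k\<in>F. walsh_r b \<alpha> d k powr lam) = (\<Sum>l\<in>?G. walsh_r b \<alpha> d (b ^ m * l) powr lam)"
    using sum.reindex[OF inj, of "\<lambda>k. walsh_r b \<alpha> d k powr lam"] by simp
  also have "(\<Sum>l\<in>?G. walsh_r b \<alpha> d (b ^ m * l) powr lam)
      \<le> (\<Sum>l\<in>?G. walsh_r b \<alpha> d l powr lam / real b ^ m)"
    by (intro sum_mono le pos)
  also have "\<dots> = (\<Sum>l\<in>?G. walsh_r b \<alpha> d l powr lam) / real b ^ m"
    by (simp add: sum_divide_distrib)
  also have "\<dots> \<le> H_tilde b \<alpha> d lam / real b ^ m"
    using pos F(1) by (intro divide_right_mono sum_walsh_r_powr_le[OF b lam]) auto
  finally show ?thesis .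
qed

section \<open>Regrouping by blocks of coordinates\<close>

lemma sum_Pow_Un_disjoint:
  assumes "A \<inter> B = {}"
  shows "(\<Sum>u\<in>Pow (A \<union> B). f u) = (\<Sum>x\<in>Pow A. \<Sum>y\<in>Pow B. f (x \<union> y))"
  unfolding sum.cartesian_product
  by (rule sum.reindex_bij_witness[where i = "\<lambda>(x, y). x \<union> y" and j = "\<lambda>u. (u \<inter> A, u \<inter> B)"])
     (use assms in \<open>auto simp flip: Int_Un_distrib simp: Int_absorb2\<close>)

lemma sum_Pow_power_card:
  fixes h :: "'b::comm_semiring_1"
  assumes "finite B"
  shows "(\<Sum>u\<in>Pow B. h ^ card u) = (1 + h) ^ card B"
  using prod_add[OF assms, of "\<lambda>_. h" "\<lambda>_. 1"] by (simp add: add.commute)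

lemma block_support_Suc:
  assumes "x \<subseteq> {1..d * s}" "y \<subseteq> {d * s + 1..d * Suc s}"
  shows "block_support (Suc s) d (x \<union> y) =
    block_support s d x \<union> (if y = {} then {} else {Suc s})"
proof -
  have y: "y \<inter> {(j - 1) * d + 1..j * d} = {}" if "j \<le> s" for j
  proof -
    have "j * d \<le> d * s" using that by (simp add: mult.commute)
    moreover have "d * s < i" if "i \<in> y" for i
      using subsetD[OF assms(2) that] by simp
    ultimately have "\<not> i \<le> j * d" if "i \<in> y" for i
      using that by (meson leD order_trans)
    then show ?thesis by auto
  qed
  have "x \<inter> {(Suc s - 1) * d + 1..Suc s * d} = {}"
    using assms(1) by (auto simp: mult.commute)
  moreover have "y \<inter> {(Suc s - 1) * d + 1..Suc s * d} = y"
    using assms(2) by (auto simp: mult.commute)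
  ultimately have last: "(x \<union> y) \<inter> {(Suc s - 1) * d + 1..Suc s * d} = y" by blast
  have old: "(x \<union> y) \<inter> {(j - 1) * d + 1..j * d} = x \<inter> {(j - 1) * d + 1..j * d}"
    if "j \<le> s" for j
    using y[OF that] by blast
  have "j \<in> block_support (Suc s) d (x \<union> y) \<longleftrightarrow>
      j \<in> block_support s d x \<union> (if y = {} then {} else {Suc s})" for j
  proof (cases "j \<le> s")
    case True
    then show ?thesis unfolding block_support_def mem_Collect_eq Un_iff old[OF True] by auto
  next
    case False
    show ?thesis
    proof (cases "j = Suc s")
      case True
      show ?thesis unfolding block_support_def mem_Collect_eq Un_iff True last by auto
    next
      case False
      with \<open>\<not> j \<le> s\<close> show ?thesis by (auto simp: block_support_def)
    qed
  qed
  then show ?thesis by blast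
qed

text \<open>A block of \<open>d\<close> coordinates that is met by \<open>u\<close> contributes the
  sum of \<open>h ^ card y\<close> over its nonempty subsets \<open>y\<close>, which is
  \<open>(1 + h) ^ d - 1\<close> by the binomial theorem. The induction on \<open>s\<close> splits
  off the last block.\<close>

lemma sum_block_support:
  fixes W :: "nat set \<Rightarrow> real"
  shows "(\<Sum>u\<in>Pow {1..d * s}. W (block_support s d u) * h ^ card u) =
    (\<Sum>v\<in>Pow {1..s}. W v * ((1 + h) ^ d - 1) ^ card v)"
proof (induction s arbitrary: W)
  case 0
  then show ?case by (simp add: block_support_def)
next
  case (Suc s)
  define H where "H = (1 + h) ^ d - 1"
  define B where "B = {d * s + 1..d * Suc s}"
  have fB: "finite B" and cB: "card B = d" by (auto simp: B_def)
  have split: "{1..d * Suc s} = {1..d * s} \<union> B" "{1..d * s} \<inter> B = {}" by (auto simp: B_def)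
  have inner: "(\<Sum>y\<in>Pow B. W (block_support (Suc s) d (x \<union> y)) * h ^ card (x \<union> y)) =
      (W (block_support s d x) + H * W (block_support s d x \<union> {Suc s})) * h ^ card x"
    if x: "x \<in> Pow {1..d * s}" for x
  proof -
    have fx: "finite x" using x finite_subset[of x "{1..d * s}"] by simp
    have card: "card (x \<union> y) = card x + card y" if "y \<in> Pow B" for y
      using that x fB split(2) fx by (intro card_Un_disjoint) (auto dest: finite_subset)
    have "(\<Sum>y\<in>Pow B. W (block_support (Suc s) d (x \<union> y)) * h ^ card (x \<union> y)) =
        (\<Sum>y\<in>Pow B. W (block_support s d x \<union> (if y = {} then {} else {Suc s})) * h ^ card x * h ^ card y)"
      using x by (intro sum.cong refl) (simp add: card block_support_Suc B_def power_add)
    \<comment> \<open>The empty \<open>y\<close> leaves the last block unmet; all other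
      \<open>y\<close> lead to one and the same block support.\<close>
    also have "\<dots> = W (block_support s d x) * h ^ card x +
        (\<Sum>y\<in>Pow B - {{}}. W (block_support s d x \<union> {Suc s}) * h ^ card x * h ^ card y)"
      using fB by (subst sum.remove[of _ "{}"]) auto
    also have "(\<Sum>y\<in>Pow B - {{}}. W (block_support s d x \<union> {Suc s}) * h ^ card x * h ^ card y)
        = W (block_support s d x \<union> {Suc s}) * h ^ card x * (\<Sum>y\<in>Pow B - {{}}. h ^ card y)"
      by (simp add: sum_distrib_left)
    also have "(\<Sum>y\<in>Pow B - {{}}. h ^ card y) = H"
      using sum_Pow_power_card[OF fB, of h] fB by (simp add: sum_diff1 H_def cB)
    finally show ?thesis by (simp add: algebra_simps)
  qed
  have inner': "(\<Sum>y\<in>Pow {Suc s}. W (v \<union> y) * H ^ card (v \<union> y)) =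
      (W v + H * W (v \<union> {Suc s})) * H ^ card v" if "v \<in> Pow {1..s}" for v
  proof -
    have "finite v" "Suc s \<notin> v" using that finite_subset[of v "{1..s}"] by auto
    then show ?thesis by (simp add: Pow_insert algebra_simps)
  qed
  have "(\<Sum>u\<in>Pow {1..d * Suc s}. W (block_support (Suc s) d u) * h ^ card u) =
      (\<Sum>x\<in>Pow {1..d * s}. (W (block_support s d x) + H * W (block_support s d x \<union> {Suc s})) * h ^ card x)"
    unfolding split(1) sum_Pow_Un_disjoint[OF split(2)] by (intro sum.cong refl inner)
  \<comment> \<open>The induction hypothesis is used for a modified weight that combines both cases
    of the last block, hence the generalization over \<open>W\<close>.\<close>
  also have "\<dots> = (\<Sum>v\<in>Pow {1..s}. (W v + H * W (v \<union> {Suc s})) * H ^ card v)"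
    using Suc.IH[of "\<lambda>v. W v + H * W (v \<union> {Suc s})"] unfolding H_def .
  also have "\<dots> = (\<Sum>v\<in>Pow {1..s}. \<Sum>y\<in>Pow {Suc s}. W (v \<union> y) * H ^ card (v \<union> y))"
    by (intro sum.cong refl inner'[symmetric])
  also have "\<dots> = (\<Sum>v\<in>Pow ({1..s} \<union> {Suc s}). W v * H ^ card v)"
    by (rule sum_Pow_Un_disjoint[symmetric]) auto
  also have "{1..s} \<union> {Suc s} = {1..Suc s}" by auto
  finally show ?case by (simp add: H_def)
qed

lemma sum_block_support_nonempty:
  fixes W :: "nat set \<Rightarrow> real"
  shows "(\<Sum>u\<in>Pow {1..d * s} - {{}}. W (block_support s d u) * h ^ card u) =
    (\<Sum>v\<in>Pow {1..s} - {{}}. W v * ((1 + h) ^ d - 1) ^ card v)"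
proof -
  have "block_support s d {} = {}" by (simp add: block_support_def)
  then show ?thesis using sum_block_support[of W s d h] by (simp add: sum_diff1)
qed

section \<open>Averaging over generating polynomials\<close>

lemma infsum_finite_sum:
  fixes f :: "'i \<Rightarrow> 'k \<Rightarrow> real"
  assumes "finite R" "\<And>x. x \<in> R \<Longrightarrow> f x summable_on A"
  shows "(\<lambda>k. \<Sum>x\<in>R. f x k) summable_on A"
    and "(\<Sum>\<^sub>\<infinity>k\<in>A. \<Sum>x\<in>R. f x k) = (\<Sum>x\<in>R. infsum (f x) A)"
proof -
  from assms have "(\<lambda>k. \<Sum>x\<in>R. f x k) summable_on A \<and>
      (\<Sum>\<^sub>\<infinity>k\<in>A. \<Sum>x\<in>R. f x k) = (\<Sum>x\<in>R. infsum (f x) A)"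
    by (induction R) (auto simp: infsum_add intro!: summable_on_add)
  then show "(\<lambda>k. \<Sum>x\<in>R. f x k) summable_on A"
    and "(\<Sum>\<^sub>\<infinity>k\<in>A. \<Sum>x\<in>R. f x k) = (\<Sum>x\<in>R. infsum (f x) A)" by auto
qed

lemma summable_prod_walsh_r_powr:
  assumes "b > 1" "lam * real (min \<alpha> d) > 1" "finite u" "A \<subseteq> {k. {j. k j \<noteq> 0} = u}"
  shows "(\<lambda>k. \<Prod>j\<in>u. walsh_r b \<alpha> d (k j) powr lam) summable_on A"
    and "(\<Sum>\<^sub>\<infinity>k\<in>A. \<Prod>j\<in>u. walsh_r b \<alpha> d (k j) powr lam) \<le> H_tilde b \<alpha> d lam ^ card u"
proof -
  have A: "A \<subseteq> {k. {j. k j \<noteq> 0} = u \<and> (\<forall>j\<in>u. k j \<in> {k. k \<noteq> 0})}" using assms(4) by auto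
  have C: "(\<Sum>k\<in>F. walsh_r b \<alpha> d k powr lam) \<le> H_tilde b \<alpha> d lam"
    if "finite F" "F \<subseteq> {k. k \<noteq> 0}" for F
    using that by (intro sum_walsh_r_powr_le assms) auto
  show "(\<lambda>k. \<Prod>j\<in>u. walsh_r b \<alpha> d (k j) powr lam) summable_on A"
    and "(\<Sum>\<^sub>\<infinity>k\<in>A. \<Prod>j\<in>u. walsh_r b \<alpha> d (k j) powr lam) \<le> H_tilde b \<alpha> d lam ^ card u"
    using summable_infsum_prod_support[OF assms(3) _ C A] by auto
qed

text \<open>The factor \<open>n\<close> is \<open>(n - 1) + 1\<close>: at most \<open>n - 1\<close>
  candidates are roots for a vector \<open>k\<close> outside \<open>Z\<close>, and the vectors in
  \<open>Z\<close>, counted for all candidates, add up to at most one further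
  \<open>H_tilde b \<alpha> d lam ^ card u\<close>.\<close>

lemma sum_infsum_dual_net_korobov_le:
  fixes p :: "'a::{field, finite} poly"
  assumes b: "prime b" "CARD('a) = b" and m: "m \<ge> 1" and p: "irreducible p" "degree p = m"
    and lam: "lam * real (min \<alpha> d) > 1" and u: "u \<subseteq> {1..n}" "u \<noteq> {}"
  shows "(\<Sum>x\<in>nonzero_polys_below m.
      \<Sum>\<^sub>\<infinity>k\<in>{k \<in> dual_net b m n (korobov_vector p x) p. {j. k j \<noteq> 0} = u}.
        \<Prod>j\<in>u. walsh_r b \<alpha> d (k j) powr lam) \<le> real n * H_tilde b \<alpha> d lam ^ card u"
proof -
  define R where "R = (nonzero_polys_below m :: 'a poly set)"
  define f where "f = (\<lambda>k :: nat \<Rightarrow> nat. \<Prod>j\<in>u. walsh_r b \<alpha> d (k j) powr lam)"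
  define h where "h = H_tilde b \<alpha> d lam"
  define A where "A = {k :: nat \<Rightarrow> nat. {j. k j \<noteq> 0} = u}"
  \<comment> \<open>The exceptional vectors: all their truncation polynomials vanish, so every
    candidate is a root and the root bound says nothing.\<close>
  define Z where "Z = {k \<in> A. \<forall>j\<in>u. b ^ m dvd k j}"
  define D where "D = (\<lambda>x. {k \<in> dual_net b m n (korobov_vector p x) p. {j. k j \<noteq> 0} = u})"
  have b1: "b > 1" using b(1) by (rule prime_gt_1_nat)
  have fu: "finite u" using u finite_subset by blast
  have n: "n \<ge> 1" using u by (cases n) auto
  have fR: "finite R" and cR: "real (card R) = real b ^ m - 1"
    using card_nonzero_polys_below[OF m, where 'a = 'a] b b1 by (auto simp: R_def of_nat_diff)
  have h0: "h \<ge> 0" unfolding h_def using b1 lam by (rule H_tilde_nonneg)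
  have f0: "f k \<ge> 0" for k by (auto simp: f_def intro!: prod_nonneg)
  have D_iff: "k \<in> D x \<longleftrightarrow> k \<in> A \<and> p dvd (\<Sum>j\<in>{1..n}. trunc_poly b m (k j) * x ^ (j - 1))" for k x
    using u(1) by (auto simp: D_def A_def mem_dual_net_korobov_iff)
  have sub: "f summable_on B" if "B \<subseteq> A" for B
    using summable_prod_walsh_r_powr(1)[OF b1 lam fu] that unfolding A_def f_def .
  have fA: "infsum f A \<le> h ^ card u"
    unfolding f_def h_def A_def by (rule summable_prod_walsh_r_powr(2)[OF b1 lam fu]) simp
  have fZ: "infsum f Z \<le> (h / real b ^ m) ^ card u"
    unfolding f_def h_def
  proof (rule summable_infsum_prod_support(2)[OF fu])
    show "(\<Sum>k\<in>F. walsh_r b \<alpha> d k powr lam) \<le> H_tilde b \<alpha> d lam / real b ^ m"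
      if "finite F" "F \<subseteq> {k. k > 0 \<and> b ^ m dvd k}" for F
      using that by (intro sum_walsh_r_powr_multiples_le[OF b1 lam]) auto
    show "Z \<subseteq> {k. {j. k j \<noteq> 0} = u \<and> (\<forall>j\<in>u. k j \<in> {k. k > 0 \<and> b ^ m dvd k})}"
      by (auto simp: Z_def A_def)
  qed simp
  \<comment> \<open>Padding with 0 puts the sums over each \<open>D x\<close> and over
    \<open>Z\<close> on the common index set \<open>A\<close>, where the finite sum over
    \<open>R\<close> can be exchanged with the infinite one.\<close>
  have ind: "(\<lambda>k. if k \<in> B then f k else 0) summable_on A"
    "(\<Sum>\<^sub>\<infinity>k\<in>A. if k \<in> B then f k else 0) = infsum f B" if "B \<subseteq> A" for B
  proof -
    have "(\<lambda>k. if k \<in> B then f k else 0) summable_on A \<longleftrightarrow> f summable_on B"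
      using that by (intro summable_on_cong_neutral) auto
    then show "(\<lambda>k. if k \<in> B then f k else 0) summable_on A" using sub[OF that] by simp
    show "(\<Sum>\<^sub>\<infinity>k\<in>A. if k \<in> B then f k else 0) = infsum f B"
      using that by (intro infsum_cong_neutral) auto
  qed
  have DA: "D x \<subseteq> A" for x using D_iff by blast
  have ZA: "Z \<subseteq> A" by (auto simp: Z_def)
  have point: "(\<Sum>x\<in>R. if k \<in> D x then f k else 0) \<le>
      real (n - 1) * f k + real (card R) * (if k \<in> Z then f k else 0)" if k: "k \<in> A" for k
  proof -
    let ?N = "card {x \<in> R. p dvd (\<Sum>j\<in>{1..n}. trunc_poly b m (k j) * x ^ (j - 1))}"
    have "(\<Sum>x\<in>R. if k \<in> D x then f k else 0) = (\<Sum>x\<in>{x \<in> R. k \<in> D x}. f k)"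
      using fR by (intro sum.inter_filter[symmetric])
    also have "\<dots> = real ?N * f k" using k by (simp add: D_iff)
    also have "\<dots> \<le> real (n - 1) * f k + real (card R) * (if k \<in> Z then f k else 0)"
    proof (cases "k \<in> Z")
      case True
      have "?N \<le> card R" using fR by (intro card_mono) auto
      then have "real ?N \<le> real (n - 1) + real (card R)" by simp
      then have "real ?N * f k \<le> (real (n - 1) + real (card R)) * f k"
        by (intro mult_right_mono f0)
      with True show ?thesis by (simp add: distrib_right)
    next
      case False
      then obtain j where j: "j \<in> u" "\<not> b ^ m dvd k j" using k by (auto simp: Z_def)
      have "?N \<le> n - 1" unfolding R_def
      proof (rule card_roots_below_le[OF p])
        show "j \<in> {1..n}" using j u by blast
        show "trunc_poly b m (k j) \<noteq> (0 :: 'a poly)"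
          using power_dvd_if_trunc_poly_eq_0[OF b] j by blast
      qed (use m degree_trunc_poly in blast)
      then show ?thesis using False f0[of k] by (simp add: mult_right_mono)
    qed
    finally show ?thesis .
  qed
  have "(\<Sum>x\<in>R. infsum f (D x)) = (\<Sum>x\<in>R. \<Sum>\<^sub>\<infinity>k\<in>A. if k \<in> D x then f k else 0)"
    by (intro sum.cong refl ind(2)[symmetric] DA)
  also have "\<dots> = (\<Sum>\<^sub>\<infinity>k\<in>A. \<Sum>x\<in>R. if k \<in> D x then f k else 0)"
    by (intro infsum_finite_sum(2)[symmetric] fR ind(1) DA)
  also have "\<dots> \<le> (\<Sum>\<^sub>\<infinity>k\<in>A. real (n - 1) * f k + real (card R) * (if k \<in> Z then f k else 0))"
    by (intro infsum_mono point infsum_finite_sum(1) fR ind(1) DA ZA summable_on_add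
          summable_on_cmult_right sub order_refl)
  also have "\<dots> = real (n - 1) * infsum f A + real (card R) * infsum f Z"
    using ind[OF ZA] sub[OF order_refl]
    by (simp only: infsum_add infsum_cmult_right' summable_on_cmult_right)
  also have "\<dots> \<le> real (n - 1) * h ^ card u + real (card R) * (h / real b ^ m) ^ card u"
    using fA fZ by (intro add_mono mult_left_mono) auto
  \<comment> \<open>Since \<open>u\<close> is nonempty, one factor \<open>1 / b ^ m\<close> is
    always available, and it outweighs \<open>card R = b ^ m - 1\<close>.\<close>
  also have "\<dots> \<le> real (n - 1) * h ^ card u + h ^ card u"
  proof -
    have "card u \<ge> 1" using u fu by (simp add: Suc_le_eq card_gt_0_iff)
    then have "(1 / real b ^ m) ^ card u \<le> (1 / real b ^ m) ^ 1"
      using b1 by (intro power_decreasing) auto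
    then have "real (card R) * (1 / real b ^ m) ^ card u \<le> real b ^ m * (1 / real b ^ m)"
      unfolding cR using b1 by (intro mult_mono) auto
    also have "\<dots> = 1" using b1 by simp
    finally have "real (card R) * (1 / real b ^ m) ^ card u * h ^ card u \<le> 1 * h ^ card u"
      using h0 by (intro mult_right_mono) auto
    then show ?thesis by (simp add: power_divide)
  qed
  also have "\<dots> = real n * h ^ card u" using n by (simp add: of_nat_diff algebra_simps)
  finally show ?thesis by (simp add: R_def f_def D_def h_def)
qed

section \<open>The criterion for a fixed vector, and the average over all candidates\<close>

lemma block_support_subset: "block_support s d u \<subseteq> {1..s}"
  by (auto simp: block_support_def)

lemma weight_tilde_nonneg: "\<gamma> v \<ge> 0 \<Longrightarrow> weight_tilde b \<alpha> d \<gamma> v \<ge> 0"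
  by (simp add: weight_tilde_def)

text \<open>Jensen's inequality is applied twice, to the finite sum over \<open>u\<close> and to
  each series over \<open>k\<close>. Both the series and that of its \<open>lam\<close>-th powers
  must converge, because \<open>infsum\<close> would be 0 otherwise; the second converges because
  \<open>lam * min \<alpha> d > 1\<close>.\<close>

lemma quality_criterion_powr_le:
  fixes q :: "nat \<Rightarrow> 'a::field poly"
  assumes b: "b > 1" and mn: "min \<alpha> d > 1" and \<gamma>: "\<And>v. v \<subseteq> {1..s} \<Longrightarrow> \<gamma> v \<ge> 0"
    and lam: "0 < lam" "lam \<le> 1" "lam * real (min \<alpha> d) > 1"
  shows "quality_criterion b m s \<alpha> d \<gamma> q p powr lam \<le>
    (\<Sum>u\<in>Pow {1..d * s} - {{}}. weight_tilde b \<alpha> d \<gamma> (block_support s d u) powr lam *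
      (\<Sum>\<^sub>\<infinity>k\<in>{k \<in> dual_net b m (d * s) q p. {j. k j \<noteq> 0} = u}.
         \<Prod>j\<in>u. walsh_r b \<alpha> d (k j) powr lam))"
proof -
  have w: "weight_tilde b \<alpha> d \<gamma> (block_support s d u) \<ge> 0" for u
    by (intro weight_tilde_nonneg \<gamma> block_support_subset)
  let ?f = "\<lambda>u k. \<Prod>j\<in>u. walsh_r b \<alpha> d (k j)"
  let ?D = "\<lambda>u. {k \<in> dual_net b m (d * s) q p. {j. k j \<noteq> 0} = u}"
  have f0: "?f u k \<ge> 0" for u k by (simp add: prod_nonneg walsh_r_nonneg)
  have f0': "infsum (?f u) (?D u) \<ge> 0" for u by (intro infsum_nonneg f0)
  have pw: "?f u k powr lam = (\<Prod>j\<in>u. walsh_r b \<alpha> d (k j) powr lam)" for u k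
    by (simp add: prod_powr_distrib walsh_r_nonneg)
  have "quality_criterion b m s \<alpha> d \<gamma> q p powr lam \<le>
    (\<Sum>u\<in>Pow {1..d * s} - {{}}. (weight_tilde b \<alpha> d \<gamma> (block_support s d u) * infsum (?f u) (?D u)) powr lam)"
    unfolding quality_criterion_def
    by (intro sum_powr_le lam mult_nonneg_nonneg w f0') auto
  also have "\<dots> \<le> (\<Sum>u\<in>Pow {1..d * s} - {{}}. weight_tilde b \<alpha> d \<gamma> (block_support s d u) powr lam *
      (\<Sum>\<^sub>\<infinity>k\<in>?D u. ?f u k powr lam))"
  proof (rule sum_mono)
    fix u assume "u \<in> Pow {1..d * s} - {{}}"
    then have fu: "finite u" using finite_subset by blast
    have "(\<lambda>k. ?f u k powr lam) summable_on ?D u"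
      unfolding pw by (rule summable_prod_walsh_r_powr[OF b lam(3) fu]) auto
    then have "infsum (?f u) (?D u) powr lam \<le> (\<Sum>\<^sub>\<infinity>k\<in>?D u. ?f u k powr lam)"
      by (intro infsum_powr_le f0 lam summable_quality_criterion[OF b mn fu])
    then show "(weight_tilde b \<alpha> d \<gamma> (block_support s d u) * infsum (?f u) (?D u)) powr lam \<le>
        weight_tilde b \<alpha> d \<gamma> (block_support s d u) powr lam * (\<Sum>\<^sub>\<infinity>k\<in>?D u. ?f u k powr lam)"
      using w[of u] f0'[of u] by (simp only: powr_mult mult_left_mono powr_ge_zero)
  qed
  finally show ?thesis unfolding pw .
qed

theorem theorem6:
  fixes b s m \<alpha> d :: nat
    and \<gamma> :: "nat set \<Rightarrow> real"
    and p q :: "'a::{field, finite} poly"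
    and lam :: real
  assumes "prime b" and "CARD('a) = b"
    and "s \<ge> 1" and "m \<ge> 1" and "\<alpha> \<ge> 1" and "d \<ge> 1"
    and "min \<alpha> d > 1"
    and "\<And>v. v \<subseteq> {1..s} \<Longrightarrow> \<gamma> v \<ge> 0"
    and "irreducible p" and "degree p = m"
    and "q \<in> nonzero_polys_below m"
    and "\<And>q'. q' \<in> nonzero_polys_below m \<Longrightarrow>
           quality_criterion b m s \<alpha> d \<gamma> (korobov_vector p q) p
             \<le> quality_criterion b m s \<alpha> d \<gamma> (korobov_vector p q') p"
    and "1 / real (min \<alpha> d) < lam" and "lam \<le> 1"
  shows "quality_criterion b m s \<alpha> d \<gamma> (korobov_vector p q) p
           \<le> real (d * s) powr (1 / lam) / (real b ^ m - 1) powr (1 / lam) *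
             (\<Sum>v\<in>Pow {1..s} - {{}}.
                weight_tilde b \<alpha> d \<gamma> v powr lam * H_const b \<alpha> d lam ^ card v) powr (1 / lam)"
proof -
  define B where "B = (\<lambda>x. quality_criterion b m s \<alpha> d \<gamma> (korobov_vector p x) p)"
  define R where "R = (nonzero_polys_below m :: 'a poly set)"
  define w where "w = (\<lambda>v. weight_tilde b \<alpha> d \<gamma> v powr lam)"
  define h where "h = H_tilde b \<alpha> d lam"
  define T where "T = (\<lambda>u x. \<Sum>\<^sub>\<infinity>k\<in>{k \<in> dual_net b m (d * s) (korobov_vector p x) p. {j. k j \<noteq> 0} = u}.
         \<Prod>j\<in>u. walsh_r b \<alpha> d (k j) powr lam)"
  define S where "S = (\<Sum>v\<in>Pow {1..s} - {{}}. w v * H_const b \<alpha> d lam ^ card v)"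
  have b1: "b > 1" using \<open>prime b\<close> by (rule prime_gt_1_nat)
  have mn0: "real (min \<alpha> d) > 0" using \<open>min \<alpha> d > 1\<close> by simp
  \<comment> \<open>The lower bound on \<open>lam\<close> in product form; all convergence of
    \<open>lam\<close>-th powers rests on it.\<close>
  with assms(13) have lam1: "lam * real (min \<alpha> d) > 1" by (simp add: field_simps)
  have "0 < 1 / real (min \<alpha> d)" using mn0 by simp
  with assms(13) have lam0: "lam > 0" by linarith
  have cR: "real (card R) = real b ^ m - 1"
    using card_nonzero_polys_below[OF \<open>m \<ge> 1\<close>, where 'a = 'a] \<open>CARD('a) = b\<close> b1
    by (auto simp: R_def of_nat_diff)
  have M: "real b ^ m - 1 > 0" using b1 \<open>m \<ge> 1\<close> by simp
  have Bnn: "B x \<ge> 0" for x unfolding B_def quality_criterion_def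
    by (intro sum_nonneg mult_nonneg_nonneg infsum_nonneg prod_nonneg walsh_r_nonneg
          weight_tilde_nonneg assms(8) block_support_subset)
  have h0: "h \<ge> 0" unfolding h_def using b1 lam1 by (rule H_tilde_nonneg)
  have H: "H_const b \<alpha> d lam = (1 + h) ^ d - 1" by (simp add: H_const_def h_def)
  then have "H_const b \<alpha> d lam \<ge> 0" using h0 by simp
  then have S0: "S \<ge> 0" unfolding S_def w_def by (intro sum_nonneg mult_nonneg_nonneg) auto
  have "(real b ^ m - 1) * B q powr lam = (\<Sum>x\<in>R. B q powr lam)" by (simp add: cR)
  \<comment> \<open>Minimality of \<open>q\<close> against each candidate; \<open>powr\<close> with
    positive exponent is monotone on the nonnegative values of \<open>B\<close>.\<close>
  also have "\<dots> \<le> (\<Sum>x\<in>R. B x powr lam)"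
    using assms(12) lam0 Bnn by (intro sum_mono powr_mono2) (auto simp: B_def R_def)
  also have "\<dots> \<le> (\<Sum>x\<in>R. \<Sum>u\<in>Pow {1..d * s} - {{}}. w (block_support s d u) * T u x)"
    unfolding B_def w_def T_def
    by (intro sum_mono quality_criterion_powr_le[OF b1 \<open>min \<alpha> d > 1\<close> assms(8) lam0 \<open>lam \<le> 1\<close> lam1])
  also have "\<dots> = (\<Sum>u\<in>Pow {1..d * s} - {{}}. w (block_support s d u) * (\<Sum>x\<in>R. T u x))"
    by (subst sum.swap) (simp only: sum_distrib_left)
  also have "\<dots> \<le> (\<Sum>u\<in>Pow {1..d * s} - {{}}. w (block_support s d u) * (real (d * s) * h ^ card u))"
    unfolding T_def R_def h_def w_def
    by (intro sum_mono mult_left_mono sum_infsum_dual_net_korobov_le assms(1,2,4,9,10) lam1) auto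
  also have "\<dots> = real (d * s) * (\<Sum>u\<in>Pow {1..d * s} - {{}}. w (block_support s d u) * h ^ card u)"
    by (simp only: sum_distrib_left mult.left_commute)
  \<comment> \<open>The weight depends on \<open>u\<close> only through the blocks that
    \<open>u\<close> meets, so powers of \<open>h\<close> over coordinates become powers of
    \<open>H_const\<close> over blocks.\<close>
  also have "\<dots> = real (d * s) * S"
    unfolding sum_block_support_nonempty S_def H ..
  finally have "B q powr lam \<le> real (d * s) * S / (real b ^ m - 1)"
    using M by (simp add: pos_le_divide_eq mult.commute)
  then have "(B q powr lam) powr (1 / lam) \<le> (real (d * s) * S / (real b ^ m - 1)) powr (1 / lam)"
    using lam0 by (intro powr_mono2) auto
  also have "(B q powr lam) powr (1 / lam) = B q"
    using lam0 Bnn by (simp add: powr_powr)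
  also have "(real (d * s) * S / (real b ^ m - 1)) powr (1 / lam) =
      real (d * s) powr (1 / lam) / (real b ^ m - 1) powr (1 / lam) * S powr (1 / lam)"
    using S0 M by (simp add: powr_divide powr_mult)
  finally show ?thesis by (simp only: B_def S_def w_def)
qed

end
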